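(* Let $p$ be an odd prime, $k$ a non-negative integer and $n\geq 2$ an integer. Then $A_{n}^{p^k}$ has at least $$\frac{n-1-p^k\cdot d_p(n)}{p-1}+k$$ factors of $p$.
   Context: Write $[m]=\{1,2,\ldots,m\}$. For a permutation $\pi$ in the symmetric group $\mathfrak{S}_n$, its descent set is $\mathrm{Des}(\pi)=\{i\in[n-1] : \pi_i>\pi_{i+1}\}$. For $S\subseteq[n-1]$, $\beta_n(S)=|\{\pi\in\mathfrak{S}_n : \mathrm{Des}(\pi)=S\}|$. Define $A^r_n=\sum_{S\subseteq[n-1]}\beta_n(S)^r$ (the superscript is an index; here $r=p^k$). For a positive integer $n$, $u_p(n)$ is the sum of the base $p$ digits of $n$, and $d_p(n)=u_p(n)-1$. An integer $N$ has at least $c$ factors of $p$ ($c$ a real number) if the $p$-adic valuation of $N$ is at least $c$. *)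

theory Defs
  imports
    "HOL-Combinatorics.Permutations"
    "HOL-Computational_Algebra.Primes"
    Complex_Main
begin

definition descent_set :: "nat \<Rightarrow> (nat \<Rightarrow> nat) \<Rightarrow> nat set" where
  "descent_set n \<pi> = {i \<in> {1..n - 1}. \<pi> i > \<pi> (i + 1)}"

definition beta :: "nat \<Rightarrow> nat set \<Rightarrow> nat" where
  "beta n S = card {\<pi>. \<pi> permutes {1..n} \<and> descent_set n \<pi> = S}"

definition beta_power_sum :: "nat \<Rightarrow> nat \<Rightarrow> nat" where
  "beta_power_sum r n = (\<Sum>S\<in>Pow {1..n - 1}. beta n S ^ r)"

(* The base p digit of n at position i is n div p ^ i mod p. For p \<ge> 2 we have n < p ^ n, so all
   digits at positions i \<ge> n vanish and the sum below runs over every nonzero digit. *)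
definition digit_sum :: "nat \<Rightarrow> nat \<Rightarrow> nat" where
  "digit_sum p n = (\<Sum>i<n. n div p ^ i mod p)"

definition digit_defect :: "nat \<Rightarrow> nat \<Rightarrow> int" where
  "digit_defect p n = int (digit_sum p n) - 1"

end

(* By inclusion-exclusion beta(S) is a signed sum over T <= S of the number alpha(T) of permutations
   with descent set inside T, a multinomial coefficient whose valuation is at least
   (|T| - d_p(n)) / (p - 1). Expanding beta(S)^r and summing over S leaves, since r = p^k is odd, only
   the tuples (T_1, ..., T_r) whose union is [n-1]. Cyclic rotation preserves the summand. A tuple
   with orbit of size p^j contributes p^j times a product of r multinomials, and being p^(k-j)-fold
   periodic it satisfies |T_1| + ... + |T_r| >= p^(k-j) (n-1). Bernoulli's inequality shows that this
   surplus compensates the k - j missing factors of p. *)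
theory Submission
  imports Defs "HOL-Combinatorics.Orbits" "HOL-Combinatorics.Cycles"
begin

section \<open>Base p digit sums and the valuations of factorials and binomial coefficients\<close>

lemma digit_sum_eq_sum:
  assumes "p \<ge> 2" "n \<le> m"
  shows "digit_sum p n = (\<Sum>i<m. n div p ^ i mod p)"
  unfolding digit_sum_def
proof (rule sum.mono_neutral_left)
  show "\<forall>i\<in>{..<m} - {..<n}. n div p ^ i mod p = 0"
  proof
    fix i assume "i \<in> {..<m} - {..<n}"
    moreover have "i < p ^ i" using assms(1) by (simp add: power_gt_expt)
    ultimately show "n div p ^ i mod p = 0" by simp
  qed
qed (use assms in auto)

lemma digit_sum_rec:
  assumes "p \<ge> 2"
  shows "digit_sum p n = n mod p + digit_sum p (n div p)"
proof -
  have "digit_sum p n = (\<Sum>i<Suc n. n div p ^ i mod p)"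
    using assms by (intro digit_sum_eq_sum) auto
  also have "\<dots> = n mod p + (\<Sum>i<n. n div p div p ^ i mod p)"
    by (subst sum.lessThan_Suc_shift) (simp add: div_mult2_eq)
  also have "(\<Sum>i<n. n div p div p ^ i mod p) = digit_sum p (n div p)"
    using assms by (intro digit_sum_eq_sum[symmetric]) auto
  finally show ?thesis .
qed

text \<open>Adding one turns each trailing digit \<open>p - 1\<close> into 0 and raises the next
  digit by 1. The number of these carries is the multiplicity of \<open>p\<close> in
  \<open>Suc n\<close>, and each costs \<open>p - 1\<close>.\<close>

lemma digit_sum_Suc:
  assumes "prime p"
  shows "digit_sum p (Suc n) + (p - 1) * multiplicity p (Suc n) = Suc (digit_sum p n)"
proof (induction n rule: less_induct)
  case (less n)
  have p: "p \<ge> 2" using assms prime_ge_2_nat by blast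
  show ?case
  proof (cases "p dvd Suc n")
    case False
    then have "Suc n div p = n div p" "Suc n mod p = Suc (n mod p)"
      by (auto simp: div_Suc mod_Suc dvd_eq_mod_eq_0 split: if_splits)
    then show ?thesis
      using digit_sum_rec[OF p, of n] digit_sum_rec[OF p, of "Suc n"] False
      by (simp add: not_dvd_imp_multiplicity_0)
  next
    case True
    then obtain m where m: "Suc n = p * Suc m"
      by (metis dvdE mult_0_right nat.distinct(1) not0_implies_Suc)
    \<comment> \<open>The carry case: the last digit of \<open>n\<close> is \<open>p - 1\<close>,
      that of \<open>Suc n\<close> is 0, and the carry turns the remaining digits from those of
      \<open>m\<close> into those of \<open>Suc m\<close>.\<close>
    have n: "n = p * m + (p - 1)" using m p by simp
    have "2 * Suc m \<le> Suc n" unfolding m using p by (rule mult_le_mono1)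
    then have mn: "m < n" by simp
    have "n div p = m" "n mod p = p - 1" using p unfolding n by (subst div_mult_self4 mod_mult_self4; simp)+
    moreover have "multiplicity p (Suc n) = Suc (multiplicity p (Suc m))"
      using assms unfolding m by (subst prime_elem_multiplicity_mult_distrib) auto
    moreover have "Suc n div p = Suc m" "Suc n mod p = 0" using p m by simp_all
    ultimately show ?thesis
      using digit_sum_rec[OF p, of n] digit_sum_rec[OF p, of "Suc n"] less.IH[OF mn] p
      by simp
  qed
qed

text \<open>Legendre's formula, obtained by summing \<open>digit_sum_Suc\<close> over the factors of
  the factorial.\<close>

lemma digit_sum_add_multiplicity_fact:
  assumes "prime p"
  shows "digit_sum p n + (p - 1) * multiplicity p (fact n :: nat) = n"
proof (induction n)
  case 0
  show ?case by (simp add: digit_sum_def)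
next
  case (Suc n)
  have "multiplicity p (fact (Suc n) :: nat) = multiplicity p (Suc n) + multiplicity p (fact n :: nat)"
    using assms by (simp only: fact_Suc of_nat_id) (simp add: prime_elem_multiplicity_mult_distrib del: mult_Suc)
  then show ?case using digit_sum_Suc[OF assms, of n] Suc by (simp add: algebra_simps)
qed

text \<open>Kummer's theorem in terms of digit sums: Legendre's formula is applied to the three
  factorials, whose arguments cancel because \<open>k + (n - k) = n\<close>.\<close>

lemma digit_sum_add_multiplicity_binomial:
  assumes "prime p" "k \<le> n"
  shows "digit_sum p n + (p - 1) * multiplicity p (n choose k) = digit_sum p k + digit_sum p (n - k)"
proof -
  have "fact k * fact (n - k) * (n choose k) = fact n"
    using assms(2) by (rule binomial_fact_lemma)
  then have "multiplicity p (fact n :: nat) =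
      multiplicity p (fact k :: nat) + multiplicity p (fact (n - k) :: nat) + multiplicity p (n choose k)"
    using assms by (simp add: prime_elem_multiplicity_mult_distrib flip: \<open>_ = fact n\<close>)
  then show ?thesis
    using digit_sum_add_multiplicity_fact[OF assms(1), of n] digit_sum_add_multiplicity_fact[OF assms(1), of k]
      digit_sum_add_multiplicity_fact[OF assms(1), of "n - k"] assms(2)
    by (simp only: distrib_left) linarith
qed

lemma digit_sum_pos:
  assumes "prime p" "n > 0"
  shows "digit_sum p n > 0"
  using assms(2)
proof (induction n rule: less_induct)
  case (less n)
  have p: "p \<ge> 2" using assms prime_ge_2_nat by blast
  show ?case
  proof (cases "n div p = 0")
    case True
    then show ?thesis using less.prems p by (subst digit_sum_rec[OF p]) (simp add: div_eq_0_iff)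
  next
    case False
    then show ?thesis using less.IH[of "n div p"] less.prems p by (subst digit_sum_rec[OF p]) simp
  qed
qed

section \<open>Words whose descents lie in a given set\<close>

text \<open>Lists are indexed from 0, so the comparison of entries \<open>i\<close> and
  \<open>Suc i\<close> concerns position \<open>Suc i\<close> of one-line notation. Elements of
  \<open>T\<close> allow a descent but do not force one. The alphabet \<open>V\<close> is arbitrary
  so that prefixes of words can be treated recursively.\<close>

definition descent_words :: "'a::linorder set \<Rightarrow> nat set \<Rightarrow> 'a list set" where
  "descent_words V T =
     {xs. distinct xs \<and> set xs = V \<and> (\<forall>i. Suc i < length xs \<longrightarrow> Suc i \<notin> T \<longrightarrow> xs ! i < xs ! Suc i)}"

lemma finite_descent_words:
  assumes "finite V"
  shows "finite (descent_words V T)"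
proof (rule finite_subset)
  show "descent_words V T \<subseteq> {xs. set xs \<subseteq> V \<and> length xs = card V}"
    by (auto simp: descent_words_def distinct_card)
qed (simp add: assms finite_lists_length_eq)

lemma descent_words_empty:
  assumes "finite V"
  shows "descent_words V {} = {sorted_list_of_set V}"
proof -
  have "descent_words V {} = {xs. sorted_wrt (<) xs \<and> set xs = V}"
    by (auto simp: descent_words_def strict_sorted_iff sorted_wrt_iff_nth_Suc_transp sorted_iff_nth_Suc
        nth_eq_iff_index_eq order.strict_iff_order)
  also have "\<dots> = {sorted_list_of_set V}"
    using assms by (auto simp: sorted_list_of_set.idem_if_sorted_distinct strict_sorted_iff)
  finally show ?thesis .
qed

text \<open>Behind the largest allowed descent \<open>t\<close> a word must increase, so it is
  determined by its first \<open>t\<close> letters. These form a word over some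
  \<open>t\<close>-subset \<open>W\<close>, subject to the remaining elements of
  \<open>T\<close>.\<close>

lemma card_descent_words_remove_Max:
  fixes V :: "'a::linorder set"
  assumes V: "finite V" and T: "finite T" "t \<in> T" "\<And>s. s \<in> T \<Longrightarrow> s \<le> t" and t: "t \<le> card V"
  shows "card (descent_words V T) =
    (\<Sum>W | W \<subseteq> V \<and> card W = t. card (descent_words W (T - {t})))"
proof -
  let ?P = "SIGMA W:{W. W \<subseteq> V \<and> card W = t}. descent_words W (T - {t})"
  let ?f = "\<lambda>xs. (set (take t xs), take t xs)"
  let ?g = "\<lambda>(W, ys). ys @ sorted_list_of_set (V - W)"
  have "bij_betw ?f (descent_words V T) ?P"
  proof (rule bij_betw_byWitness[where f' = ?g])
    show "\<forall>xs\<in>descent_words V T. ?g (?f xs) = xs"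
    proof
      fix xs assume xs: "xs \<in> descent_words V T"
      then have len: "length xs = card V" by (auto simp: descent_words_def distinct_card)
      have d: "distinct xs" "set xs = V" using xs by (auto simp: descent_words_def)
      have s: "sorted_wrt (<) (drop t xs)"
        unfolding sorted_wrt_iff_nth_Suc_transp[OF transp_on_less]
      proof (intro allI impI)
        fix i assume i: "Suc i < length (drop t xs)"
        then have "Suc (t + i) \<notin> T" using T(3) by force
        then show "drop t xs ! i < drop t xs ! Suc i"
          using xs i by (auto simp: descent_words_def add.commute)
      qed
      have "set (drop t xs) = V - set (take t xs)"
      proof -
        have "distinct (take t xs @ drop t xs)" "set (take t xs @ drop t xs) = V"
          using d by (simp_all only: append_take_drop_id)
        then show ?thesis unfolding distinct_append set_append by blast
      qed
      then have "drop t xs = sorted_list_of_set (V - set (take t xs))"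
        using sorted_list_of_set.idem_if_sorted_distinct[of "drop t xs"] s by (simp add: strict_sorted_iff)
      then have "?g (?f xs) = take t xs @ drop t xs" by (simp only: prod.case)
      then show "?g (?f xs) = xs" by (simp only: append_take_drop_id)
    qed
    show "\<forall>q\<in>?P. ?f (?g q) = q"
    proof
      fix q assume "q \<in> ?P"
      then obtain W ys where q: "q = (W, ys)" "card W = t" "ys \<in> descent_words W (T - {t})" by blast
      then have "set ys = W" "length ys = t"
        by (auto simp: descent_words_def distinct_card)
      then show "?f (?g q) = q" by (simp add: q(1))
    qed
    show "?f ` descent_words V T \<subseteq> ?P"
    proof (rule image_subsetI)
      fix xs assume xs: "xs \<in> descent_words V T"
      then have len: "length xs = card V" by (auto simp: descent_words_def distinct_card)
      have d: "distinct xs" "set xs = V" using xs by (auto simp: descent_words_def)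
      have "card (set (take t xs)) = t" using d len t by (simp add: distinct_card)
      moreover have "set (take t xs) \<subseteq> V" using d by (auto dest: in_set_takeD)
      \<comment> \<open>Only positions below \<open>t\<close> occur inside the prefix, so
        \<open>T\<close> and \<open>T - {t}\<close> impose the same conditions on it.\<close>
      moreover have "take t xs \<in> descent_words (set (take t xs)) (T - {t})"
        using xs d by (auto simp: descent_words_def)
      ultimately show "(set (take t xs), take t xs) \<in> ?P" by simp
    qed
    show "?g ` ?P \<subseteq> descent_words V T"
    proof (rule image_subsetI)
      fix q assume "q \<in> ?P"
      then obtain W ys where q: "q = (W, ys)" and W: "W \<subseteq> V" "card W = t"
        and ys: "ys \<in> descent_words W (T - {t})" by blast
      have fin: "finite (V - W)" "finite W" using V W finite_subset by auto
      have len: "length ys = t" using ys W by (auto simp: descent_words_def distinct_card)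
      let ?zs = "sorted_list_of_set (V - W)"
      have z: "sorted_wrt (<) ?zs" by (simp add: strict_sorted_iff)
      have "(ys @ ?zs) ! i < (ys @ ?zs) ! Suc i"
        if i: "Suc i < length (ys @ ?zs)" "Suc i \<notin> T" for i
      proof -
        consider "Suc i < t" | "Suc i = t" | "i \<ge> t" by linarith
        then show ?thesis
        proof cases
          case 1
          then show ?thesis using ys i len W by (auto simp: descent_words_def nth_append)
        next
          \<comment> \<open>The junction of prefix and tail is position \<open>t\<close> itself,
            where no condition is imposed.\<close>
          case 2
          then show ?thesis using T i by simp
        next
          case 3
          then show ?thesis using z i len
            by (auto simp: nth_append sorted_wrt_iff_nth_less Suc_diff_le)
        qed
      qed
      then show "?g q \<in> descent_words V T"
        unfolding q using ys W fin by (auto simp: descent_words_def)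
    qed
  qed
  then have "card (descent_words V T) = card ?P" by (rule bij_betw_same_card)
  also have "\<dots> = (\<Sum>W | W \<subseteq> V \<and> card W = t. card (descent_words W (T - {t})))"
    using V by (intro card_SigmaI) (auto intro: finite_descent_words finite_subset)
  finally show ?thesis .
qed

text \<open>Each element of \<open>T\<close> contributes one binomial coefficient, and their valuations telescope.\<close>

lemma card_le_multiplicity_descent_words:
  assumes "prime p" "n > 0" "T \<subseteq> {1..n - 1}"
  shows "\<exists>c>0. (\<forall>V::'a::linorder set. finite V \<and> card V = n \<longrightarrow> card (descent_words V T) = c) \<and>
    card T + 1 \<le> (p - 1) * multiplicity p c + digit_sum p n"
  using assms(2,3)
proof (induction "card T" arbitrary: n T)
  case 0
  then have "T = {}" using finite_subset by fastforce
  then show ?case using digit_sum_pos[OF assms(1) \<open>n > 0\<close>]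
    by (intro exI[of _ 1]) (auto simp: descent_words_empty)
next
  case (Suc m)
  have fin: "finite T" using Suc.prems finite_subset by blast
  define t where "t = Max T"
  have t: "t \<in> T" using fin Suc by (metis Max_in card.empty nat.distinct(1) t_def)
  have max: "s \<le> t" if "s \<in> T" for s using fin that by (simp add: t_def)
  have tn: "0 < t" "t < n" using t Suc.prems by force+
  have card: "card (T - {t}) = m" using t Suc.hyps(2) by simp
  have "T - {t} \<subseteq> {1..t - 1}"
  proof
    fix s assume "s \<in> T - {t}"
    then have "s \<le> t" "s \<noteq> t" "s \<ge> 1" using max Suc.prems by auto
    then show "s \<in> {1..t - 1}" by simp
  qed
  \<comment> \<open>That \<open>c\<close> depends only on the size of \<open>W\<close> makes the sum
    over all \<open>W\<close> collapse to \<open>n choose t\<close> copies of it.\<close>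
  then obtain c where c: "c > 0" "\<And>W::'a set. finite W \<Longrightarrow> card W = t \<Longrightarrow> card (descent_words W (T - {t})) = c"
    "m + 1 \<le> (p - 1) * multiplicity p c + digit_sum p t"
    using Suc.hyps(1)[of "T - {t}" t] card tn by auto
  have words: "card (descent_words V T) = (n choose t) * c" if V: "finite V" "card V = n" for V :: "'a set"
  proof -
    have "card (descent_words V T) = (\<Sum>W | W \<subseteq> V \<and> card W = t. card (descent_words W (T - {t})))"
      using V fin t max tn by (intro card_descent_words_remove_Max) auto
    also have "\<dots> = (\<Sum>W | W \<subseteq> V \<and> card W = t. c)"
    proof (rule sum.cong)
      fix W assume "W \<in> {W. W \<subseteq> V \<and> card W = t}"
      then show "card (descent_words W (T - {t})) = c" using V finite_subset by (intro c(2)) auto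
    qed simp
    finally show ?thesis using V by (simp add: n_subsets)
  qed
  have pos: "n choose t > 0" using tn by simp
  have mult: "multiplicity p ((n choose t) * c) = multiplicity p (n choose t) + multiplicity p c"
    using assms(1) pos c(1) by (simp add: prime_elem_multiplicity_mult_distrib)
  \<comment> \<open>Kummer's theorem replaces \<open>digit_sum p t\<close> in the bound for
    \<open>c\<close> by the valuation of the binomial plus \<open>digit_sum p n\<close> minus
    \<open>digit_sum p (n - t)\<close>. The last digit sum is at least 1, which pays for the element
    \<open>t\<close>.\<close>
  have "card T + 1 \<le> (p - 1) * multiplicity p ((n choose t) * c) + digit_sum p n"
    using c(3) digit_sum_add_multiplicity_binomial[OF assms(1), of t n] digit_sum_pos[OF assms(1), of "n - t"] tn Suc.hyps(2)
    unfolding mult distrib_left by linarith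
  then show ?case using pos c(1) words by (intro exI[of _ "(n choose t) * c"]) auto
qed

section \<open>Divisibility of sums that are invariant under an action of prime power order\<close>

text \<open>The size of an orbit divides \<open>p ^ k\<close>, hence is some \<open>p ^ j\<close>.
  Since \<open>F\<close> is constant on the orbit of \<open>x\<close>, that orbit contributes
  \<open>p ^ j\<close> times \<open>F x\<close>, so divisibility can be checked orbit by
  orbit.\<close>

lemma dvd_sum_prime_power_orbits:
  fixes F :: "'a \<Rightarrow> 'b::comm_semiring_1"
  assumes p: "prime p" and X: "finite X" "\<And>x. x \<in> X \<Longrightarrow> g x \<in> X"
    and per: "\<And>x. x \<in> X \<Longrightarrow> (g ^^ (p ^ k)) x = x"
    and inv: "\<And>x. x \<in> X \<Longrightarrow> F (g x) = F x"
    and dvd: "\<And>x j. x \<in> X \<Longrightarrow> j \<le> k \<Longrightarrow> (g ^^ (p ^ j)) x = x \<Longrightarrow> N dvd of_nat (p ^ j) * F x"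
  shows "N dvd sum F X"
proof -
  have pos: "p ^ k > 0" using p prime_gt_0_nat by simp
  have iter: "(g ^^ m) x \<in> X" "F ((g ^^ m) x) = F x" if "x \<in> X" for x m
    using that by (induction m) (auto simp: X inv)
  \<comment> \<open>\<open>orbit g x\<close> starts with \<open>g x\<close>, so periodicity is what
    brings \<open>x\<close> itself back into it.\<close>
  have self: "x \<in> orbit g x" if "x \<in> X" for x
    using per[OF that] pos unfolding orbit_altdef by (metis (mono_tags, lifting) mem_Collect_eq)
  have "N dvd sum F {y \<in> X. orbit g y = orbit g x}" if x: "x \<in> X" for x
  proof -
    define l where "l = least_power g x"
    have l: "(g ^^ l) x = x" "l > 0" using least_powerI[OF per[OF x] pos] by (simp_all add: l_def)
    have "l dvd p ^ k" unfolding l_def using per[OF x] by (rule least_power_minimal)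
    then obtain j where j: "j \<le> k" "l = p ^ j" using p by (auto simp: divides_primepow_nat)
    have orb: "orbit g x = (\<lambda>m. (g ^^ m) x) ` {..<l}"
      using orbit_altdef_bounded[OF l] by auto
    have "inj_on (\<lambda>m. (g ^^ m) x) {..<l}"
    proof (rule linorder_inj_onI)
      fix a b assume ab: "a < b" "a \<in> {..<l}" "b \<in> {..<l}"
      show "(g ^^ a) x \<noteq> (g ^^ b) x"
      proof
        assume "(g ^^ a) x = (g ^^ b) x"
        \<comment> \<open>A coincidence of two iterates would give the positive period
          \<open>l - b + a\<close>, smaller than the least one.\<close>
        then have "(g ^^ (l - b)) ((g ^^ a) x) = (g ^^ (l - b)) ((g ^^ b) x)" by simp
        then have "(g ^^ (l - b + a)) x = x" using ab l by (simp flip: funpow_add[unfolded o_def, THEN fun_cong])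
        then have "l \<le> l - b + a" unfolding l_def using ab by (intro least_power_le) (auto simp: l_def)
        then show False using ab by simp
      qed
    qed auto
    then have card: "card (orbit g x) = l" by (simp add: orb card_image)
    have eq: "{y \<in> X. orbit g y = orbit g x} = orbit g x"
    proof (intro equalityI subsetI)
      fix y assume "y \<in> {y \<in> X. orbit g y = orbit g x}"
      then show "y \<in> orbit g x" using self by auto
    next
      fix y assume y: "y \<in> orbit g x"
      then have yX: "y \<in> X" using iter x by (auto simp: orb)
      have "x \<in> orbit g y" using y self[OF x] by (rule orbit_swap[rotated])
      then have "orbit g y = orbit g x" using y by (blast intro: orbit_trans)
      then show "y \<in> {y \<in> X. orbit g y = orbit g x}" using yX by simp
    qed
    have "sum F (orbit g x) = (\<Sum>y\<in>orbit g x. F x)"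
      by (rule sum.cong) (auto simp: orb iter x)
    then show ?thesis using dvd[OF x j(1)] l j card by (simp add: eq)
  qed
  then have "N dvd (\<Sum>A\<in>orbit g ` X. sum F {y \<in> X. orbit g y = A})"
    by (intro dvd_sum[of "orbit g ` X"]) blast
  then show ?thesis by (simp flip: sum.image_gen[OF X(1)])
qed

section \<open>Expansion of power sums over subsets into tuples, and periodic tuples\<close>

lemma sum_power_eq_sum_lists:
  fixes f :: "'a \<Rightarrow> 'b::comm_semiring_1"
  assumes "finite A"
  shows "(\<Sum>x\<in>A. f x) ^ r = (\<Sum>xs | set xs \<subseteq> A \<and> length xs = r. prod_list (map f xs))"
proof (induction r)
  case 0
  have "{xs. set xs \<subseteq> A \<and> length xs = 0} = {[]}" by auto
  then show ?case by simp
next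
  case (Suc r)
  let ?L = "{xs. set xs \<subseteq> A \<and> length xs = r}"
  have "(\<Sum>xs | set xs \<subseteq> A \<and> length xs = Suc r. prod_list (map f xs)) =
      (\<Sum>(xs, x)\<in>?L \<times> A. prod_list (map f xs) * f x)"
    unfolding lists_length_Suc_eq
    by (subst sum.reindex) (auto simp: inj_on_def mult.commute intro!: sum.cong)
  also have "\<dots> = (\<Sum>x\<in>A. f x) ^ Suc r"
    by (simp only: power_Suc2 Suc sum_product sum.cartesian_product)
  finally show ?case ..
qed

text \<open>Unless \<open>U = N\<close>, as many supersets of \<open>U\<close> within
  \<open>N\<close> have even as odd size. This cancellation is what leaves only tuples covering
  \<open>N\<close>.\<close>

lemma sum_supersets_minus_one_power:
  assumes "finite N" "U \<subseteq> N"
  shows "(\<Sum>S | S \<subseteq> N \<and> U \<subseteq> S. (-1) ^ card S) = (if U = N then (-1) ^ card N else (0::'b::ring_1))"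
proof (cases "U = N")
  case True
  then have "{S. S \<subseteq> N \<and> U \<subseteq> S} = {N}" by auto
  then show ?thesis using True by simp
next
  case False
  then have "card {S. S \<subseteq> N \<and> U \<subseteq> S \<and> even (card S)} = card {S. S \<subseteq> N \<and> U \<subseteq> S \<and> odd (card S)}"
    using assms by (intro card_subsupersets_even_odd) auto
  then show ?thesis using False assms(1)
    by (subst sum_alternating_cancels) (simp_all add: conj_assoc)
qed

text \<open>The power expands into tuples of subsets of \<open>S\<close>. After exchanging sums, a
  tuple with union \<open>U\<close> is weighted by the alternating sum over all \<open>S\<close>
  between \<open>U\<close> and \<open>N\<close>.\<close>

lemma sum_Pow_power_eq_sum_covers:
  fixes h :: "'a set \<Rightarrow> 'b::comm_ring_1"
  assumes N: "finite N" and r: "odd r"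
  shows "(\<Sum>S\<in>Pow N. ((-1) ^ card S * (\<Sum>T\<in>Pow S. h T)) ^ r) =
    (-1) ^ card N * (\<Sum>xs | length xs = r \<and> \<Union>(set xs) = N. prod_list (map h xs))"
proof -
  let ?L = "{xs. set xs \<subseteq> Pow N \<and> length xs = r}"
  have L: "finite ?L" using N by (intro finite_lists_length_eq) simp
  have "((-1) ^ card S * (\<Sum>T\<in>Pow S. h T)) ^ r =
      (\<Sum>xs | xs \<in> ?L \<and> \<Union>(set xs) \<subseteq> S. (-1) ^ card S * prod_list (map h xs))" if S: "S \<subseteq> N" for S
  proof -
    \<comment> \<open>Oddness of \<open>r\<close> enters here: an even power would destroy the sign
      and with it the later cancellation.\<close>
    have "((-1::'b) ^ card S) ^ r = (-1) ^ card S"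
      using r by (cases "even (card S)") (simp_all add: uminus_power_if)
    moreover have "{xs. set xs \<subseteq> Pow S \<and> length xs = r} = {xs. xs \<in> ?L \<and> \<Union>(set xs) \<subseteq> S}"
      using S by blast
    ultimately show ?thesis
      using S N by (simp only: power_mult_distrib sum_power_eq_sum_lists finite_subset finite_Pow_iff
          flip: sum_distrib_left)
  qed
  then have "(\<Sum>S\<in>Pow N. ((-1) ^ card S * (\<Sum>T\<in>Pow S. h T)) ^ r) =
      (\<Sum>S\<in>Pow N. \<Sum>xs | xs \<in> ?L \<and> \<Union>(set xs) \<subseteq> S. (-1) ^ card S * prod_list (map h xs))"
    by (intro sum.cong) auto
  also have "\<dots> = (\<Sum>xs\<in>?L. \<Sum>S | S \<in> Pow N \<and> \<Union>(set xs) \<subseteq> S. (-1) ^ card S * prod_list (map h xs))"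
    using N L by (intro sum.swap_restrict) auto
  also have "\<dots> = (\<Sum>xs\<in>?L. if \<Union>(set xs) = N then (-1) ^ card N * prod_list (map h xs) else 0)"
  proof (rule sum.cong)
    fix xs assume "xs \<in> ?L"
    then have "\<Union>(set xs) \<subseteq> N" by blast
    from sum_supersets_minus_one_power[OF N this, where 'b = 'b]
    show "(\<Sum>S | S \<in> Pow N \<and> \<Union>(set xs) \<subseteq> S. (-1) ^ card S * prod_list (map h xs)) =
      (if \<Union>(set xs) = N then (-1) ^ card N * prod_list (map h xs) else 0)"
      by (simp flip: sum_distrib_right)
  qed simp
  also have "\<dots> = (\<Sum>xs | xs \<in> ?L \<and> \<Union>(set xs) = N. (-1) ^ card N * prod_list (map h xs))"
    by (simp only: sum.inter_filter[OF L])
  also have "{xs. xs \<in> ?L \<and> \<Union>(set xs) = N} = {xs. length xs = r \<and> \<Union>(set xs) = N}" by blast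
  finally show ?thesis by (simp add: sum_distrib_left)
qed

text \<open>Such a list consists of \<open>m\<close> copies of one block of length \<open>q\<close>.
  Each copy already has the full union, so its cardinalities add up to at least that of the
  union.\<close>

lemma card_Union_le_sum_list_card:
  fixes xs :: "'a set list"
  assumes len: "length xs = m * q" and rot: "rotate q xs = xs"
  shows "m * card (\<Union>(set xs)) \<le> sum_list (map card xs)"
proof (cases "q = 0")
  case True
  then show ?thesis using len by simp
next
  case False
  have rot': "rotate (l * q) xs = xs" for l
    by (induction l) (simp_all add: rot flip: rotate_rotate)
  have nth: "xs ! i = xs ! (i mod q)" if "i < m * q" for i
  proof -
    have "xs ! (i mod q) = rotate (i div q * q) xs ! (i mod q)" by (simp only: rot')
    also have "\<dots> = xs ! ((i div q * q + i mod q) mod length xs)"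
      using that len mod_less_eq_dividend[of i q] by (intro nth_rotate) linarith
    finally show ?thesis using that len by simp
  qed
  have "card (\<Union>(set xs)) \<le> (\<Sum>i\<in>{l * q..<l * q + q}. card (xs ! i))" if l: "l < m" for l
  proof -
    have lq: "l * q + q \<le> m * q" using mult_le_mono1[of "Suc l" m q] l by simp
    have "(\<Union>i\<in>{l * q..<l * q + q}. xs ! i) = \<Union>(set xs)"
    proof (intro equalityI subsetI)
      fix x assume "x \<in> (\<Union>i\<in>{l * q..<l * q + q}. xs ! i)"
      then show "x \<in> \<Union>(set xs)" using lq len by (auto intro!: nth_mem)
    next
      fix x assume "x \<in> \<Union>(set xs)"
      then obtain i where i: "i < m * q" "x \<in> xs ! i" using len by (auto simp: in_set_conv_nth)
      have "i mod q < q" using False by simp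
      then have "xs ! (l * q + i mod q) = xs ! (i mod q)" using nth[of "l * q + i mod q"] lq by simp
      then show "x \<in> (\<Union>i\<in>{l * q..<l * q + q}. xs ! i)"
        using i nth[of i] \<open>i mod q < q\<close> by (intro UN_I[of "l * q + i mod q"]) auto
    qed
    then show ?thesis by (metis card_UN_le finite_atLeastLessThan)
  qed
  then have "(\<Sum>l<m. card (\<Union>(set xs))) \<le> (\<Sum>l<m. \<Sum>i\<in>{l * q..<l * q + q}. card (xs ! i))"
    by (intro sum_mono) simp
  also have "\<dots> = (\<Sum>i<m * q. card (xs ! i))" by (rule sum.nat_group)
  also have "\<dots> = sum_list (map card xs)"
    by (simp add: sum_list_sum_nth len atLeast0LessThan)
  finally show ?thesis by simp
qed

lemma prod_list_map_rotate1:
  fixes f :: "'a \<Rightarrow> 'b::comm_monoid_mult"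
  shows "prod_list (map f (rotate1 xs)) = prod_list (map f xs)"
  by (cases xs) (simp_all add: mult.commute)

section \<open>Descent classes of permutations in terms of words\<close>

text \<open>The bijection is one-line notation; the inverse \<open>?g\<close> shifts indices by one
  and fixes everything outside \<open>{1..n}\<close>, as \<open>permutes\<close> demands.\<close>

lemma card_descent_set_subset:
  "card {\<pi>. \<pi> permutes {1..n} \<and> descent_set n \<pi> \<subseteq> T} = card (descent_words {1..n} T)"
proof (rule bij_betw_same_card)
  let ?P = "{\<pi>. \<pi> permutes {1..n} \<and> descent_set n \<pi> \<subseteq> T}"
  let ?f = "\<lambda>\<pi>::nat \<Rightarrow> nat. map \<pi> [1..<Suc n]"
  let ?g = "\<lambda>xs i. if i \<in> {1..n} then xs ! (i - 1) else i"
  show "bij_betw ?f ?P (descent_words {1..n} T)"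
  proof (rule bij_betw_byWitness[where f' = ?g])
    show "\<forall>\<pi>\<in>?P. ?g (?f \<pi>) = \<pi>"
    proof
      fix \<pi> assume "\<pi> \<in> ?P"
      then have "\<pi> permutes {1..n}" by simp
      show "?g (?f \<pi>) = \<pi>"
      proof
        fix i
        show "?g (?f \<pi>) i = \<pi> i"
          using permutes_not_in[OF \<open>\<pi> permutes {1..n}\<close>, of i]
          by (auto simp del: upt_Suc)
      qed
    qed
    have words: "length xs = n" "set xs = {1..n}" "distinct xs" if "xs \<in> descent_words {1..n} T" for xs
      using that distinct_card[of xs] by (auto simp: descent_words_def)
    show "\<forall>xs\<in>descent_words {1..n} T. ?f (?g xs) = xs"
      by (auto intro!: nth_equalityI simp: words simp del: upt_Suc)
    show "?f ` ?P \<subseteq> descent_words {1..n} T"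
    proof (rule image_subsetI)
      fix \<pi> assume "\<pi> \<in> ?P"
      then have \<pi>: "\<pi> permutes {1..n}" and des: "descent_set n \<pi> \<subseteq> T" by auto
      have "distinct (?f \<pi>)" using permutes_inj_on[OF \<pi>] by (simp add: distinct_map del: upt_Suc)
      moreover have "set (?f \<pi>) = {1..n}"
        using permutes_image[OF \<pi>] by (simp add: atLeastLessThanSuc_atLeastAtMost del: upt_Suc)
      moreover have "?f \<pi> ! i < ?f \<pi> ! Suc i" if i: "Suc i < length (?f \<pi>)" "Suc i \<notin> T" for i
      proof -
        have "Suc i \<in> {1..n - 1}" using i by (simp del: upt_Suc)
        then have "\<not> \<pi> (Suc i) > \<pi> (Suc (Suc i))" using i des by (auto simp: descent_set_def simp del: upt_Suc)
        moreover have "\<pi> (Suc i) \<noteq> \<pi> (Suc (Suc i))" using permutes_inj[OF \<pi>] by (simp add: inj_eq)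
        ultimately show ?thesis using i by (simp del: upt_Suc)
      qed
      ultimately show "?f \<pi> \<in> descent_words {1..n} T" by (simp add: descent_words_def del: upt_Suc)
    qed
    show "?g ` descent_words {1..n} T \<subseteq> ?P"
    proof (rule image_subsetI)
      fix xs assume xs: "xs \<in> descent_words {1..n} T"
      note w = words[OF xs]
      have "?g xs permutes {1..n}"
      proof (rule bij_imp_permutes)
        have "bij_betw (\<lambda>i. i - 1) {1..n} {..<n}"
          by (rule bij_betw_byWitness[where f' = Suc]) auto
        then have "bij_betw ((!) xs \<circ> (\<lambda>i. i - 1)) {1..n} {1..n}"
          using bij_betw_nth[OF w(3), of "{..<n}" "{1..n}"] w by (intro bij_betw_trans) auto
        then show "bij_betw (?g xs) {1..n} {1..n}"
          by (rule bij_betw_cong[THEN iffD1, rotated]) auto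
      qed auto
      moreover have "descent_set n (?g xs) \<subseteq> T"
      proof
        fix i assume "i \<in> descent_set n (?g xs)"
        then have i: "1 \<le> i" "i < n" "xs ! i < xs ! (i - 1)"
          by (auto simp: descent_set_def split: if_splits)
        then obtain l where "i = Suc l" by (cases i) auto
        then show "i \<in> T" using xs i w by (auto simp: descent_words_def)
      qed
      ultimately show "?g xs \<in> ?P" by blast
    qed
  qed
qed

lemma finite_permutations_Collect: "finite {\<pi>. \<pi> permutes {1..n::nat} \<and> P \<pi>}"
  by (rule finite_subset[OF _ finite_permutations[of "{1..n}"]]) auto

lemma beta_eq_alternating_sum:
  assumes "finite S"
  shows "int (beta n S) =
    (-1) ^ card S * (\<Sum>T\<in>Pow S. (-1) ^ card T * int (card (descent_words {1..n} T)))"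
proof -
  let ?P = "\<lambda>S. {\<pi>. \<pi> permutes {1..n} \<and> descent_set n \<pi> = S}"
  \<comment> \<open>The two signs cancel; they give the relation the self-inverse shape that
    \<open>inclusion_exclusion_symmetric\<close> expects.\<close>
  have "int (card (descent_words {1..n} T)) = (\<Sum>S\<in>Pow T. (-1) ^ card S * ((-1) ^ card S * int (beta n S)))"
    if T: "finite T" for T
  proof -
    have "{\<pi>. \<pi> permutes {1..n} \<and> descent_set n \<pi> \<subseteq> T} = (\<Union>S\<in>Pow T. ?P S)" by auto
    then have "card (descent_words {1..n} T) = card (\<Union>S\<in>Pow T. ?P S)"
      by (simp only: card_descent_set_subset[symmetric])
    also have "\<dots> = (\<Sum>S\<in>Pow T. beta n S)"
      unfolding beta_def using T by (intro card_UN_disjoint ballI finite_permutations_Collect) auto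
    finally show ?thesis by (simp flip: mult.assoc power_add)
  qed
  from inclusion_exclusion_symmetric[OF this assms]
  have "(-1) ^ card S * int (beta n S) = (\<Sum>T\<in>Pow S. (-1) ^ card T * int (card (descent_words {1..n} T)))"
    by simp
  then have "(-1) ^ card S * (\<Sum>T\<in>Pow S. (-1) ^ card T * int (card (descent_words {1..n} T))) =
      (-1) ^ card S * ((-1) ^ card S * int (beta n S))" by simp
  then show ?thesis by (simp flip: mult.assoc power_add)
qed

text \<open>The descent class of the identity is nonempty. Positivity matters because
  \<open>multiplicity p 0\<close> is 0 by convention, so divisibility bounds the multiplicity only
  for nonzero numbers.\<close>

lemma beta_power_sum_pos: "beta_power_sum r n > 0"
proof -
  let ?S = "descent_set n id"
  have "id \<in> {\<pi>. \<pi> permutes {1..n} \<and> descent_set n \<pi> = ?S}" by simp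
  then have "beta n ?S > 0" unfolding beta_def card_gt_0_iff
    using finite_permutations_Collect[of n "\<lambda>\<pi>. descent_set n \<pi> = ?S"] by blast
  moreover have "?S \<in> Pow {1..n - 1}" by (auto simp: descent_set_def)
  ultimately show ?thesis unfolding beta_power_sum_def by (intro sum_pos2[of _ ?S]) auto
qed

section \<open>Valuations of products over tuples and the final estimate\<close>

lemma multiplicity_prod_list:
  fixes p :: nat
  assumes "prime p" "\<And>x. x \<in> set xs \<Longrightarrow> f x > (0::nat)"
  shows "prod_list (map f xs) > 0 \<and>
    multiplicity p (prod_list (map f xs)) = sum_list (map (\<lambda>x. multiplicity p (f x)) xs)"
  using assms(2)
  by (induction xs) (use assms(1) in \<open>auto simp: prime_elem_multiplicity_mult_distrib\<close>)

lemma prod_list_signed: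
  "prod_list (map (\<lambda>x. (-1) ^ g x * int (f x)) xs) = (-1) ^ sum_list (map g xs) * int (prod_list (map f xs))"
  by (induction xs) (simp_all add: power_add algebra_simps)

theorem proposition5p1:
  fixes p k n :: nat
  assumes "prime p" and "odd p" and "n \<ge> 2"
  shows "real (multiplicity p (beta_power_sum (p ^ k) n))
           \<ge> (real n - 1 - real p ^ k * real_of_int (digit_defect p n)) / (real p - 1) + real k"
proof -
  define N where "N = {1..n - 1}"
  define \<alpha> where "\<alpha> T = card (descent_words {1..n} T)" for T
  define h where "h T = (-1) ^ card T * int (\<alpha> T)" for T
  define X where "X = {xs. length xs = p ^ k \<and> \<Union>(set xs) = N}"
  define E where "E = (real n - 1 - real p ^ k * real_of_int (digit_defect p n)) / (real p - 1) + real k"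
  \<comment> \<open>\<open>E\<close> may be negative; then \<open>e\<close> is 0 and the
    divisibility is trivial.\<close>
  define e where "e = nat \<lceil>E\<rceil>"
  have p: "p \<ge> 2" using assms(1) prime_ge_2_nat by blast
  have N: "finite N" "card N = n - 1" by (simp_all add: N_def)
  have \<alpha>: "\<alpha> T > 0" "int (card T) - digit_defect p n \<le> int (p - 1) * int (multiplicity p (\<alpha> T))"
    if T: "T \<subseteq> N" for T
  proof -
    obtain c where c: "c > 0" "\<forall>V::nat set. finite V \<and> card V = n \<longrightarrow> card (descent_words V T) = c"
      "card T + 1 \<le> (p - 1) * multiplicity p c + digit_sum p n"
      using card_le_multiplicity_descent_words[of p n T] assms T unfolding N_def by auto
    have "\<alpha> T = c" using c(2) by (simp add: \<alpha>_def)
    moreover have "int (card T) + 1 \<le> int (p - 1) * int (multiplicity p c) + int (digit_sum p n)"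
      using c(3) by (simp flip: of_nat_mult of_nat_add of_nat_Suc)
    ultimately show "\<alpha> T > 0" "int (card T) - digit_defect p n \<le> int (p - 1) * int (multiplicity p (\<alpha> T))"
      using c(1) by (simp_all add: digit_defect_def)
  qed
  have "int (beta_power_sum (p ^ k) n) = (\<Sum>S\<in>Pow N. ((-1) ^ card S * (\<Sum>T\<in>Pow S. h T)) ^ (p ^ k))"
    unfolding beta_power_sum_def h_def \<alpha>_def N_def of_nat_sum of_nat_power
    by (intro sum.cong refl) (simp add: beta_eq_alternating_sum finite_subset)
  also have "\<dots> = (-1) ^ card N * (\<Sum>xs\<in>X. prod_list (map h xs))"
    unfolding X_def using N(1) assms(2) by (intro sum_Pow_power_eq_sum_covers) auto
  finally have A: "int (beta_power_sum (p ^ k) n) = (-1) ^ card N * (\<Sum>xs\<in>X. prod_list (map h xs))" .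
  have "int (p ^ e) dvd (\<Sum>xs\<in>X. prod_list (map h xs))"
  proof (rule dvd_sum_prime_power_orbits[where g = rotate1 and k = k])
    show "prime p" by fact
    show "finite X"
      by (rule finite_subset[OF _ finite_lists_length_eq[of "Pow N" "p ^ k"]]) (auto simp: X_def N(1))
    show "rotate1 xs \<in> X" if "xs \<in> X" for xs using that by (simp add: X_def)
    show "(rotate1 ^^ (p ^ k)) xs = xs" if "xs \<in> X" for xs
      using that by (simp add: X_def flip: rotate_def)
    show "prod_list (map h (rotate1 xs)) = prod_list (map h xs)" for xs by (rule prod_list_map_rotate1)
    fix xs j assume xs: "xs \<in> X" and j: "j \<le> k" and "(rotate1 ^^ (p ^ j)) xs = xs"
    then have rot: "rotate (p ^ j) xs = xs" by (simp add: rotate_def)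
    define v where "v = multiplicity p (prod_list (map \<alpha> xs))"
    \<comment> \<open>\<open>m\<close> counts the factors of \<open>p\<close> lost to the short
      orbit, while the tuple repeats a block \<open>p ^ m\<close> times.\<close>
    define m where "m = k - j"
    have len: "length xs = p ^ m * p ^ j" using xs j by (simp add: X_def m_def flip: power_add)
    have sub: "T \<subseteq> N" if "T \<in> set xs" for T using that xs by (auto simp: X_def)
    have v: "v = sum_list (map (\<lambda>T. multiplicity p (\<alpha> T)) xs)"
      using multiplicity_prod_list[OF assms(1), of xs \<alpha>] \<alpha>(1) sub by (simp add: v_def)
    \<comment> \<open>The bounds for the single \<open>\<alpha> T\<close> are added up along the
      tuple, for arbitrary \<open>ys\<close> so that induction applies.\<close>
    have "int (sum_list (map card ys)) - int (length ys) * digit_defect p n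
        \<le> int (p - 1) * int (sum_list (map (\<lambda>T. multiplicity p (\<alpha> T)) ys))"
      if "\<And>T. T \<in> set ys \<Longrightarrow> T \<subseteq> N" for ys
      using that
    proof (induction ys)
      case (Cons T ys)
      have "int (card T) - digit_defect p n \<le> int (p - 1) * int (multiplicity p (\<alpha> T))"
        using Cons.prems by (intro \<alpha>(2)) simp
      then show ?case using Cons by (simp add: algebra_simps)
    qed simp
    from this[of xs] sub have "int (sum_list (map card xs)) - int (p ^ k) * digit_defect p n \<le> int (p - 1) * int v"
      using xs by (auto simp: v X_def)
    moreover have "p ^ m * (n - 1) \<le> sum_list (map card xs)"
      using card_Union_le_sum_list_card[OF len rot] xs by (simp add: X_def N(2))
    ultimately have "int (p ^ m * (n - 1)) - int (p ^ k) * digit_defect p n \<le> int (p - 1) * int v"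
      by linarith
    then have 1: "real p ^ m * (real n - 1) - real p ^ k * digit_defect p n \<le> (real p - 1) * real v"
      using p assms(3) by (simp add: of_nat_diff flip: of_int_le_iff[where 'a = real])
    \<comment> \<open>Bernoulli gives \<open>p ^ m - 1 \<ge> m * (p - 1)\<close>. Since
      \<open>n - 1 \<ge> 1\<close>, the surplus \<open>(p ^ m - 1) * (n - 1)\<close> over one copy
      of \<open>n - 1\<close> makes up for the \<open>m\<close> lost factors.\<close>
    have "1 + real m * (real p - 1) \<le> (1 + (real p - 1)) ^ m"
      using p by (intro Bernoulli_inequality) simp
    then have "real m * (real p - 1) \<le> real p ^ m - 1" by simp
    also have "\<dots> \<le> (real p ^ m - 1) * (real n - 1)"
      using p assms(3) mult_left_mono[of 1 "real n - 1" "real p ^ m - 1"] by simp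
    finally have "real n - 1 - real p ^ k * digit_defect p n \<le> (real p - 1) * (real v - real m)"
      using 1 by (simp add: algebra_simps)
    then have "E \<le> real v - real m + real k"
      using p unfolding E_def by (simp add: divide_le_eq mult.commute)
    then have "E \<le> real (j + v)" using j by (simp add: m_def of_nat_diff)
    then have "e \<le> j + v" unfolding e_def by linarith
    then have "p ^ e dvd p ^ j * p ^ v" by (simp add: le_imp_power_dvd flip: power_add)
    also have "p ^ j * p ^ v dvd p ^ j * prod_list (map \<alpha> xs)"
      unfolding v_def by (intro mult_dvd_mono multiplicity_dvd) simp
    finally have "int (p ^ e) dvd int (p ^ j * prod_list (map \<alpha> xs))" by (simp only: int_dvd_int_iff)
    then show "int (p ^ e) dvd of_nat (p ^ j) * prod_list (map h xs)"
      unfolding h_def prod_list_signed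
      by (simp add: mult.left_commute[of _ "(-1) ^ sum_list (map card xs)"] dvd_mult)
  qed
  then have "int (p ^ e) dvd int (beta_power_sum (p ^ k) n)" unfolding A by (rule dvd_mult)
  then have "p ^ e dvd beta_power_sum (p ^ k) n" by (simp only: int_dvd_int_iff)
  then have "e \<le> multiplicity p (beta_power_sum (p ^ k) n)"
    using beta_power_sum_pos[of "p ^ k" n] p by (intro multiplicity_geI) auto
  then show ?thesis unfolding E_def[symmetric] e_def by linarith
qed

end
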